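(* Assume there are $\vartheta\in[0,1]$ and $L_\vartheta \ge 0$ with $D_f(u,v) \le \frac{L_\vartheta}{1+\vartheta}\|u-v\|^{1+\vartheta}$ for all $u,v\in\mathbb{R}^d$. Let $\{x_k\}$ be generated from $x_0\in\mathcal{X}\setminus\mathcal{X}_\star$ by $$x_{k+1} = \mathrm{Proj}_{\mathcal{X} \cap \mathcal{H}_{x_k}(\nabla f(x_k),\, s_k)}(x_k)$$ with any (possibly adaptively chosen) depths satisfying $t(x_k) \le s_k \le s_\star(x_k)$ for all $k$, the run stopping if some $x_k\in\mathcal{X}_\star$. Then, for every $K\ge 1$, $$\min_{0\le k\le K}\bigl(f(x_k)-f_\star\bigr) \le \frac{L_\vartheta}{1+\vartheta}\left(\frac{\operatorname{dist}^2(x_0,\mathcal{X}_\star)}{K}\right)^{\frac{1+\vartheta}{2}} .$$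
   Context: Standing assumption: $\mathcal{X} \subseteq \mathbb{R}^d$ is non-empty, closed and convex; $f:\mathbb{R}^d\to\mathbb{R}$ is convex and differentiable; the solution set $\mathcal{X}_\star := \operatorname{argmin}_{z\in\mathcal{X}} f(z)$ is non-empty. Write $f_\star := \min_{z\in\mathcal{X}} f(z)$. Norms and inner products are Euclidean. For $x\in\mathcal{X}\setminus\mathcal{X}_\star$ one has $\nabla f(x)\neq 0$. $D_f(u,v) := f(u)-f(v)-\langle\nabla f(v),u-v\rangle$ is the Bregman divergence. $\mathrm{Proj}_{\mathcal{C}}$ is the Euclidean projection onto a non-empty closed convex set $\mathcal{C}$, $\operatorname{dist}$ the Euclidean distance. For $x\in\mathcal{X}\setminus\mathcal{X}_\star$: $t(x) := \frac{f(x)-f_\star}{\|\nabla f(x)\|}$ (Polyak radius) and $s_\star(x) := \inf_{x_\star\in\mathcal{X}_\star}\left\langle \frac{\nabla f(x)}{\|\nabla f(x)\|}, x-x_\star\right\rangle$; one has $s_\star(x)\ge t(x)>0$. For $g\ne 0$ and $s\ge0$, $\mathcal{H}_x(g,s) := \left\{z\in\mathbb{R}^d : \left\langle \frac{g}{\|g\|}, x-z\right\rangle \ge s\right\}$. Convention: if the run stops at some $x_j\in\mathcal{X}_\star$ with $j\le K$, the minimum is over the iterates generated and equals $0$. *)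

theory Defs
  imports "HOL-Analysis.Analysis"
begin

definition gradient :: "('a::euclidean_space \<Rightarrow> real) \<Rightarrow> 'a \<Rightarrow> 'a" where
  "gradient f x = (THE g. GDERIV f x :> g)"

lemma gradient_eqI:
  assumes "GDERIV f x :> g"
  shows "gradient f x = g"
  unfolding gradient_def
proof (rule the_equality)
  show "GDERIV f x :> g" by (rule assms)
next
  fix h assume "GDERIV f x :> h"
  then have "(\<lambda>y. y \<bullet> h) = (\<lambda>y. y \<bullet> g)"
    using assms unfolding gderiv_def by (rule has_derivative_unique)
  then show "h = g"
    by (metis vector_eq_ldot)
qed

lemma GDERIV_gradient:
  assumes "f differentiable (at x)"
  shows "GDERIV f x :> gradient f x"
proof -
  from assms obtain D where D: "(f has_derivative D) (at x)"
    unfolding differentiable_def by blast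
  then have "linear D" by (rule has_derivative_linear)
  then have "D = (\<lambda>y. y \<bullet> adjoint D 1)"
    by (simp add: adjoint_works fun_eq_iff)
  with D have "GDERIV f x :> adjoint D 1"
    unfolding gderiv_def by metis
  with gradient_eqI show ?thesis by metis
qed

definition bregman :: "('a::euclidean_space \<Rightarrow> real) \<Rightarrow> 'a \<Rightarrow> 'a \<Rightarrow> real" where
  "bregman f u v = f u - f v - gradient f v \<bullet> (u - v)"

definition solution_set :: "('a::euclidean_space \<Rightarrow> real) \<Rightarrow> 'a set \<Rightarrow> 'a set" where
  "solution_set f X = {x. is_arg_min f (\<lambda>z. z \<in> X) x}"

text \<open>The infimum is the minimum of \<open>f\<close> over \<open>X\<close> whenever the solution set is
  non-empty, see \<open>opt_value_eq\<close>.\<close>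

definition opt_value :: "('a::euclidean_space \<Rightarrow> real) \<Rightarrow> 'a set \<Rightarrow> real" where
  "opt_value f X = (INF z\<in>X. f z)"

lemma opt_value_eq:
  assumes "z \<in> solution_set f X"
  shows "opt_value f X = f z"
  unfolding opt_value_def
  using assms by (intro cInf_eq_minimum) (auto simp: solution_set_def is_arg_min_linorder)

definition polyak_radius :: "('a::euclidean_space \<Rightarrow> real) \<Rightarrow> 'a set \<Rightarrow> 'a \<Rightarrow> real" where
  "polyak_radius f X x = (f x - opt_value f X) / norm (gradient f x)"

definition max_depth :: "('a::euclidean_space \<Rightarrow> real) \<Rightarrow> 'a set \<Rightarrow> 'a \<Rightarrow> real" where
  "max_depth f X x =
     (INF z\<in>solution_set f X. (gradient f x /\<^sub>R norm (gradient f x)) \<bullet> (x - z))"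

definition halfspace :: "'a::euclidean_space \<Rightarrow> 'a \<Rightarrow> real \<Rightarrow> 'a set" where
  "halfspace x g s = {z. (g /\<^sub>R norm g) \<bullet> (x - z) \<ge> s}"

text \<open>A run that stops is encoded by a total sequence whose entries after the first
  solution are unconstrained: \<open>generated f X x k\<close> says that the method has not stopped
  before producing the iterate \<open>x k\<close>.\<close>

definition generated :: "('a::euclidean_space \<Rightarrow> real) \<Rightarrow> 'a set \<Rightarrow> (nat \<Rightarrow> 'a) \<Rightarrow> nat \<Rightarrow> bool" where
  "generated f X x k \<longleftrightarrow> (\<forall>j<k. x j \<notin> solution_set f X)"

definition is_run ::
  "('a::euclidean_space \<Rightarrow> real) \<Rightarrow> 'a set \<Rightarrow> (nat \<Rightarrow> 'a) \<Rightarrow> (nat \<Rightarrow> real) \<Rightarrow> bool" where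
  "is_run f X x s \<longleftrightarrow>
     x 0 \<in> X - solution_set f X \<and>
     (\<forall>k. generated f X x k \<and> x k \<notin> solution_set f X \<longrightarrow>
        polyak_radius f X (x k) \<le> s k \<and> s k \<le> max_depth f X (x k) \<and>
        x (Suc k) = closest_point (X \<inter> halfspace (x k) (gradient f (x k)) (s k)) (x k))"

end

theory Submission
  imports Defs
begin

text \<open>The depth bound \<open>s\<^sub>k \<le> s\<^sub>\<star>(x\<^sub>k)\<close> keeps all solutions inside the set onto which \<open>x\<^sub>k\<close> is
  projected, so with \<open>d\<^sub>k = \<parallel>x\<^sub>k\<^sub>+\<^sub>1 - x\<^sub>k\<parallel>\<close> the obtuse angle property of projections gives
  \<open>\<parallel>x\<^sub>k\<^sub>+\<^sub>1 - z\<parallel>\<^sup>2 + d\<^sub>k\<^sup>2 \<le> \<parallel>x\<^sub>k - z\<parallel>\<^sup>2\<close> for every solution \<open>z\<close>; summing up, some \<open>k < K\<close> has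
  \<open>d\<^sub>k\<^sup>2 \<le> dist\<^sup>2(x\<^sub>0, X\<^sub>\<star>) / K\<close>. The bound \<open>t(x\<^sub>k) \<le> s\<^sub>k\<close> says that the linearisation of \<open>f\<close> at \<open>x\<^sub>k\<close>
  is at most \<open>f\<^sub>\<star>\<close> at \<open>x\<^sub>k\<^sub>+\<^sub>1\<close>, so \<open>f(x\<^sub>k\<^sub>+\<^sub>1) - f\<^sub>\<star>\<close> is bounded by the Bregman
  divergence, that is, by \<open>L d\<^sub>k\<^bsup>1+\<theta>\<^esup> / (1 + \<theta>)\<close>.\<close>

text \<open>Composing \<open>f\<close> with the affine path from \<open>v\<close> to
  \<open>u\<close> reduces this to the tangent inequality for convex functions of one real
  variable.\<close>

lemma convex_above_gradient:
  fixes f :: "'a::euclidean_space \<Rightarrow> real"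
  assumes "convex_on UNIV f" and "f differentiable (at v)"
  shows "f u \<ge> f v + gradient f v \<bullet> (u - v)"
proof -
  define p where "p = (\<lambda>t::real. v + t *\<^sub>R (u - v))"
  have "(f has_derivative (\<lambda>h. h \<bullet> gradient f v)) (at (p 0))"
    using GDERIV_gradient[OF assms(2)] by (simp add: gderiv_def p_def)
  moreover have "(p has_derivative (\<lambda>t. t *\<^sub>R (u - v))) (at 0)"
    unfolding p_def by (auto intro!: derivative_eq_intros)
  ultimately have "((\<lambda>t. f (p t)) has_derivative (\<lambda>t. t *\<^sub>R (u - v) \<bullet> gradient f v)) (at 0)"
    using has_derivative_compose by blast
  then have deriv: "((\<lambda>t. f (p t)) has_real_derivative gradient f v \<bullet> (u - v)) (at 0)"
    by (simp add: has_field_derivative_def inner_commute mult_commute_abs)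
  have "convex_on UNIV (\<lambda>t. f (p t))"
  proof (rule convex_onI)
    fix t a b :: real
    assume "0 < t" "t < 1"
    moreover have "p ((1 - t) *\<^sub>R a + t *\<^sub>R b) = (1 - t) *\<^sub>R p a + t *\<^sub>R p b"
      by (simp add: p_def algebra_simps)
    ultimately show "f (p ((1 - t) *\<^sub>R a + t *\<^sub>R b)) \<le> (1 - t) * f (p a) + t * f (p b)"
      using convex_onD[OF assms(1), of t "p a" "p b"] by simp
  qed simp
  from convex_on_imp_above_tangent[OF this _ _ _ deriv, of 1]
  show ?thesis by (simp add: p_def)
qed

text \<open>With \<open>p\<close> the projection, the right side minus the left is twice the inner
  product of \<open>x - p\<close> and \<open>p - z\<close>, which is nonnegative by the obtuse angle
  at \<open>p\<close>.\<close>

lemma closest_point_pythagoras: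
  fixes x :: "'a::euclidean_space"
  assumes "convex C" and "closed C" and "z \<in> C"
  shows "(norm (closest_point C x - z))\<^sup>2 + (norm (closest_point C x - x))\<^sup>2 \<le> (norm (x - z))\<^sup>2"
  using closest_point_dot[OF assms, of x]
  by (simp add: power2_norm_eq_inner inner_commute algebra_simps)

text \<open>Closedness lets the distance to the solutions be attained. It holds because the
  solutions are the part of \<open>X\<close> in a closed sublevel set of \<open>f\<close>.\<close>

lemma closed_solution_set:
  assumes "closed X" and "continuous_on UNIV f"
  shows "closed (solution_set f X)"
proof (cases "solution_set f X = {}")
  case False
  then obtain z where z: "z \<in> solution_set f X" by blast
  then have "solution_set f X = X \<inter> {y. f y \<le> f z}"
    by (force simp: solution_set_def is_arg_min_linorder intro: order_trans)
  moreover have "closed {y. f y \<le> f z}"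
    using assms(2) by (intro closed_Collect_le continuous_intros) auto
  ultimately show ?thesis
    using assms(1) by (simp add: closed_Int)
qed simp

lemma halfspace_closed_convex: "closed (halfspace x g s)" "convex (halfspace x g s)"
proof -
  have eq: "halfspace x g s = {z. (g /\<^sub>R norm g) \<bullet> z \<le> (g /\<^sub>R norm g) \<bullet> x - s}"
    by (auto simp: halfspace_def inner_diff_right)
  show "closed (halfspace x g s)" "convex (halfspace x g s)"
    unfolding eq by (rule closed_halfspace_le, rule convex_halfspace_le)
qed

text \<open>A stationary point of a convex function is a global minimizer. So away from the
  solutions it is safe to divide by the norm of the gradient.\<close>

lemma gradient_nonzero:
  fixes f :: "'a::euclidean_space \<Rightarrow> real"
  assumes "convex_on UNIV f" and "f differentiable (at x)" and "x \<in> X" and "x \<notin> solution_set f X"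
  shows "gradient f x \<noteq> 0"
proof
  assume "gradient f x = 0"
  then have "f x \<le> f u" for u
    using convex_above_gradient[OF assms(1,2), of u] by simp
  with assms(3,4) show False
    by (simp add: solution_set_def is_arg_min_linorder)
qed

text \<open>A real infimum is a lower bound only once the family is known to be bounded below. Here
  0 is such a bound, as the linearisation of \<open>f\<close> at \<open>x\<close> lies below
  \<open>f\<close> and a solution has value at most \<open>f x\<close>.\<close>

lemma max_depth_le:
  fixes f :: "'a::euclidean_space \<Rightarrow> real"
  assumes "convex_on UNIV f" and "f differentiable (at x)" and "x \<in> X"
    and "z \<in> solution_set f X"
  shows "max_depth f X x \<le> (gradient f x /\<^sub>R norm (gradient f x)) \<bullet> (x - z)"
  unfolding max_depth_def
proof (rule cINF_lower[OF _ assms(4)], rule bdd_belowI2[of _ 0])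
  fix w assume "w \<in> solution_set f X"
  then have "f w \<le> f x"
    using assms(3) by (simp add: solution_set_def is_arg_min_linorder)
  then have "0 \<le> gradient f x \<bullet> (x - w)"
    using convex_above_gradient[OF assms(1,2), of w] by (simp add: inner_diff_right)
  then show "0 \<le> (gradient f x /\<^sub>R norm (gradient f x)) \<bullet> (x - w)"
    by simp
qed

context
  fixes f :: "'a::euclidean_space \<Rightarrow> real" and X :: "'a set" and x y :: 'a and s :: real
  assumes X: "closed X" "convex X"
    and f: "convex_on UNIV f" "f differentiable (at x)"
    and sol: "solution_set f X \<noteq> {}"
    and x: "x \<in> X" "x \<notin> solution_set f X"
    and s: "polyak_radius f X x \<le> s" "s \<le> max_depth f X x"
    and y: "y = closest_point (X \<inter> halfspace x (gradient f x) s) x"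
begin

lemma solution_set_subset_step: "solution_set f X \<subseteq> X \<inter> halfspace x (gradient f x) s"
proof
  fix z assume z: "z \<in> solution_set f X"
  then have "z \<in> X" by (simp add: solution_set_def is_arg_min_def)
  moreover have "s \<le> (gradient f x /\<^sub>R norm (gradient f x)) \<bullet> (x - z)"
    using s(2) max_depth_le[OF f x(1) z] by linarith
  ultimately show "z \<in> X \<inter> halfspace x (gradient f x) s"
    by (simp add: halfspace_def)
qed

text \<open>Any solution witnesses that the set is non-empty, so that \<open>closest_point\<close>
  really lies in it.\<close>

lemma step_in: "y \<in> X \<inter> halfspace x (gradient f x) s"
  unfolding y using X(1) sol solution_set_subset_step
  by (intro closest_point_in_set closed_Int halfspace_closed_convex) auto

lemma step_pythagoras:
  assumes "z \<in> solution_set f X"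
  shows "(norm (y - z))\<^sup>2 + (norm (y - x))\<^sup>2 \<le> (norm (x - z))\<^sup>2"
  unfolding y using X assms solution_set_subset_step
  by (intro closest_point_pythagoras closed_Int convex_Int halfspace_closed_convex) auto

lemma step_value_le_bregman: "f y - opt_value f X \<le> bregman f y x"
proof -
  let ?g = "gradient f x"
  have "norm ?g > 0"
    using gradient_nonzero[OF f x] by simp
  \<comment> \<open>The depth \<open>s\<close> is the intermediate term: it is at least the Polyak
    radius and at most the depth at which \<open>y\<close> lies.\<close>
  moreover have "(f x - opt_value f X) / norm ?g \<le> ?g \<bullet> (x - y) / norm ?g"
    using s(1) step_in by (simp add: polyak_radius_def halfspace_def divide_inverse_commute)
  ultimately have "f x - opt_value f X \<le> ?g \<bullet> (x - y)"
    by (simp add: divide_le_cancel)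
  then show ?thesis
    by (simp add: bregman_def inner_diff_right)
qed

end

theorem theorem3:
  fixes f :: "'a::euclidean_space \<Rightarrow> real"
    and X :: "'a set"
    and \<theta> L :: real
    and x :: "nat \<Rightarrow> 'a"
    and s :: "nat \<Rightarrow> real"
    and K :: nat
  assumes "X \<noteq> {}" and "closed X" and "convex X"
    and "convex_on UNIV f" and "\<And>u. f differentiable (at u)"
    and "solution_set f X \<noteq> {}"
    and "0 \<le> \<theta>" and "\<theta> \<le> 1" and "L \<ge> 0"
    and "\<And>u v. bregman f u v \<le> L / (1 + \<theta>) * norm (u - v) powr (1 + \<theta>)"
    and "is_run f X x s"
    and "K \<ge> 1"
  shows "Min ((\<lambda>k. f (x k) - opt_value f X) ` {k. k \<le> K \<and> generated f X x k})
           \<le> L / (1 + \<theta>) * ((infdist (x 0) (solution_set f X))\<^sup>2 / real K) powr ((1 + \<theta>) / 2)"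
    (is "Min (?gap ` ?I) \<le> ?R")
proof -
  let ?S = "solution_set f X"
  have Min_le_gap: "Min (?gap ` ?I) \<le> ?gap k" if "k \<in> ?I" for k
    using that by (intro Min_le) auto
  show ?thesis
  proof (cases "\<exists>j\<le>K. x j \<in> ?S")
    case True
    \<comment> \<open>The least such \<open>j\<close> is taken, because entries after the first
      solution do not count as generated.\<close>
    then obtain j where j: "j \<le> K" "x j \<in> ?S" "\<forall>i<j. x i \<notin> ?S"
      using exists_least_iff[of "\<lambda>j. j \<le> K \<and> x j \<in> ?S"] by (metis less_imp_le order_trans)
    have "Min (?gap ` ?I) \<le> ?gap j"
      using j by (intro Min_le_gap) (auto simp: generated_def)
    also have "\<dots> = 0"
      using opt_value_eq[OF j(2)] by simp
    also have "0 \<le> ?R"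
      using assms(7,9) by simp
    finally show ?thesis .
  next
    case False
    then have gen: "generated f X x k" "x k \<notin> ?S" if "k \<le> K" for k
      using that by (auto simp: generated_def)
    then have run: "polyak_radius f X (x k) \<le> s k" "s k \<le> max_depth f X (x k)"
      "x (Suc k) = closest_point (X \<inter> halfspace (x k) (gradient f (x k)) (s k)) (x k)"
      if "k \<le> K" for k
      using that assms(11) by (auto simp: is_run_def)
    have in_X: "x k \<in> X" if "k \<le> K" for k
      using that
    proof (induction k)
      case 0
      then show ?case using assms(11) by (simp add: is_run_def)
    next
      case (Suc k)
      then show ?case
        using step_in[OF assms(2-6) _ gen(2) run(1,2) run(3), of k] by simp
    qed
    note step = assms(2-6) in_X gen(2) run(1,2) run(3)
    have "closed ?S"
      using assms(2,5) differentiable_imp_continuous_on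
      by (intro closed_solution_set) (auto simp: differentiable_on_def)
    \<comment> \<open>One solution nearest to \<open>x 0\<close> serves for all steps, so the
      telescoped bound is exactly the squared distance.\<close>
    then obtain z where z: "z \<in> ?S" "infdist (x 0) ?S = norm (x 0 - z)"
      using infdist_attains_inf[of ?S "x 0"] assms(6) by (auto simp: dist_norm)
    define d where "d k = norm (x (Suc k) - x k)" for k
    have telescope: "(norm (x n - z))\<^sup>2 + (\<Sum>k<n. (d k)\<^sup>2) \<le> (norm (x 0 - z))\<^sup>2" if "n \<le> K" for n
      using that
    proof (induction n)
      case (Suc n)
      then show ?case
        using step_pythagoras[OF step z(1), of n] by (simp add: d_def)
    qed simp
    \<comment> \<open>Averaging: if all \<open>K\<close> squared steps exceeded the mean bound,
      their sum would exceed the telescoped one.\<close>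
    have "\<exists>k<K. (d k)\<^sup>2 \<le> (norm (x 0 - z))\<^sup>2 / K"
    proof (rule ccontr)
      assume "\<not> ?thesis"
      then have "(\<Sum>k<K. (norm (x 0 - z))\<^sup>2 / K) < (\<Sum>k<K. (d k)\<^sup>2)"
        using assms(12) by (intro sum_strict_mono) (auto simp: not_le lessThan_empty_iff)
      moreover have "(\<Sum>k<K. (norm (x 0 - z))\<^sup>2 / K) = (norm (x 0 - z))\<^sup>2"
        using assms(12) by simp
      moreover have "(\<Sum>k<K. (d k)\<^sup>2) \<le> (norm (x 0 - z))\<^sup>2"
        using telescope[of K] zero_le_power2[of "norm (x K - z)"] by linarith
      ultimately show False by linarith
    qed
    then obtain k where k: "k < K" "(d k)\<^sup>2 \<le> (infdist (x 0) ?S)\<^sup>2 / K"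
      using z(2) by auto
    \<comment> \<open>The short step from \<open>x k\<close> controls the gap at its endpoint, and
      \<open>k < K\<close> keeps the index \<open>Suc k\<close> within range.\<close>
    have "Min (?gap ` ?I) \<le> ?gap (Suc k)"
      using k gen by (intro Min_le_gap) auto
    also have "\<dots> \<le> bregman f (x (Suc k)) (x k)"
      using k by (intro step_value_le_bregman[OF step]) auto
    also have "\<dots> \<le> L / (1 + \<theta>) * d k powr (1 + \<theta>)"
      unfolding d_def by (rule assms(10))
    \<comment> \<open>The power is rewritten over the squared step, for which the bound is known.
      When \<open>d k = 0\<close>, both sides are 0.\<close>
    also have "d k powr (1 + \<theta>) = ((d k)\<^sup>2) powr ((1 + \<theta>) / 2)"
      by (cases "d k = 0") (auto simp: d_def powr_powr add_divide_distrib simp flip: powr_numeral)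
    also have "L / (1 + \<theta>) * \<dots> \<le> ?R"
      using k(2) assms(7,9) by (intro mult_left_mono powr_mono2) auto
    finally show ?thesis .
  qed
qed

end
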